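(* Let $Y\in[M]=\{1,\dots,M\}$, $R\in\{0,1\}$, and $F$ taking values in a finite set $\mathcal F$, with $\mathbb{P}(F=f,R=1)>0$ for all $f\in\mathcal F$. Define $B\in\mathbb{R}^{|\mathcal F|\times M}$ by $B_{fy}=\mathbb{P}(Y=y\mid F=f,R=1)$ and $H\in\mathbb{R}^{|\mathcal F|\times M}$ by $H_{fy}=\mathbb{P}(F=f,Y=y)$. Say that completeness holds if for every function $h:[M]\to\mathbb{R}$, $\mathbb{E}[h(Y)\mid F=f,R=1]=0$ for all $f\in\mathcal F$ implies $h(y)=0$ for all $y\in[M]$. Then: (i) completeness holds if and only if $\operatorname{rank}(B)=M$. (ii) Suppose in addition that $F$ is conditionally independent of $R$ given $Y$, that $\pi(y):=\mathbb{P}(R=1\mid Y=y)\in[\underline\pi,\overline\pi]$ for all $y$, and that $\mathbb{P}(F=f,R=1)\in[\underline p_F,\overline p_F]$ for all $f$, where $\underline\pi>0$ and $\underline p_F>0$. Then completeness holds if and only if $\operatorname{rank}(H)=M$, and in that case \[\kappa(B)\le \frac{\overline p_F}{\underline p_F}\cdot\frac{\overline\pi}{\underline\pi}\cdot\kappa(H),\] where for a matrix $G$ with full column rank, $\kappa(G)=\sigma_{\max}(G)/\sigma_{\min}(G)$ is the ratio of its largest to its smallest singular value.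
   Context: Here $F$ plays the role of an always-observed auxiliary prediction of the outcome $Y$ (a shadow variable), and the covariate $X$ is suppressed (equivalently, everything is conditional on a fixed value of $X$). *)

theory Defs
  imports "HOL-Analysis.Analysis" "HOL-Probability.Probability"
begin

text \<open>Joint law of (F, Y, R) is a pmf P on 'f \<times> 'y \<times> bool, with 'f the finite
  set of values of F, 'y the outcome set [M] (M = CARD('y)) and R = 1 encoded as True.\<close>

definition pFR :: "('f \<times> 'y \<times> bool) pmf \<Rightarrow> 'f \<Rightarrow> real" where
  "pFR P f = measure_pmf.prob P {(f', y', r'). f' = f \<and> r'}"

definition pFYR :: "('f \<times> 'y \<times> bool) pmf \<Rightarrow> 'f \<Rightarrow> 'y \<Rightarrow> bool \<Rightarrow> real" where
  "pFYR P f y r = measure_pmf.prob P {(f, y, r)}"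

definition pFY :: "('f \<times> 'y \<times> bool) pmf \<Rightarrow> 'f \<Rightarrow> 'y \<Rightarrow> real" where
  "pFY P f y = measure_pmf.prob P {(f', y', r'). f' = f \<and> y' = y}"

definition pY :: "('f \<times> 'y \<times> bool) pmf \<Rightarrow> 'y \<Rightarrow> real" where
  "pY P y = measure_pmf.prob P {(f', y', r'). y' = y}"

definition pYR :: "('f \<times> 'y \<times> bool) pmf \<Rightarrow> 'y \<Rightarrow> bool \<Rightarrow> real" where
  "pYR P y r = measure_pmf.prob P {(f', y', r'). y' = y \<and> r' = r}"

text \<open>pi(y) = P(R = 1 | Y = y)\<close>
definition piR :: "('f \<times> 'y \<times> bool) pmf \<Rightarrow> 'y \<Rightarrow> real" where
  "piR P y = pYR P y True / pY P y"

text \<open>B_{fy} = P(Y = y | F = f, R = 1)\<close>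
definition Bmat :: "('f::finite \<times> 'y::finite \<times> bool) pmf \<Rightarrow> real^'y^'f" where
  "Bmat P = (\<chi> f y. pFYR P f y True / pFR P f)"

text \<open>H_{fy} = P(F = f, Y = y)\<close>
definition Hmat :: "('f::finite \<times> 'y::finite \<times> bool) pmf \<Rightarrow> real^'y^'f" where
  "Hmat P = (\<chi> f y. pFY P f y)"

text \<open>E[h(Y) | F = f, R = 1]\<close>
definition cond_exp_hY :: "('f \<times> 'y::finite \<times> bool) pmf \<Rightarrow> ('y \<Rightarrow> real) \<Rightarrow> 'f \<Rightarrow> real" where
  "cond_exp_hY P h f = (\<Sum>y\<in>UNIV. h y * (pFYR P f y True / pFR P f))"

definition completeness :: "('f \<times> 'y::finite \<times> bool) pmf \<Rightarrow> bool" where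
  "completeness P \<longleftrightarrow>
     (\<forall>h :: 'y \<Rightarrow> real. (\<forall>f. cond_exp_hY P h f = 0) \<longrightarrow> (\<forall>y. h y = 0))"

text \<open>F conditionally independent of R given Y (discrete):
  P(F=f,Y=y,R=r) P(Y=y) = P(F=f,Y=y) P(Y=y,R=r).\<close>
definition cond_indep_FR_given_Y :: "('f \<times> 'y \<times> bool) pmf \<Rightarrow> bool" where
  "cond_indep_FR_given_Y P \<longleftrightarrow>
     (\<forall>f y r. pFYR P f y r * pY P y = pFY P f y * pYR P y r)"

text \<open>Singular values of G: square roots of the eigenvalues of G^T G.\<close>
definition eigenvalues_of :: "real^'n^'n \<Rightarrow> real set" where
  "eigenvalues_of A = {l. \<exists>v. v \<noteq> 0 \<and> A *v v = l *\<^sub>R v}"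

definition singular_values :: "real^'n^'m \<Rightarrow> real set" where
  "singular_values G = sqrt ` eigenvalues_of (transpose G ** G)"

definition sigma_max :: "real^'n^'m \<Rightarrow> real" where
  "sigma_max G = Max (singular_values G)"

definition sigma_min :: "real^'n^'m \<Rightarrow> real" where
  "sigma_min G = Min (singular_values G)"

definition cond_number :: "real^'n^'m \<Rightarrow> real" where
  "cond_number G = sigma_max G / sigma_min G"

end

theory Submission
  imports Defs
begin

text \<open>Completeness says exactly that \<open>h \<mapsto> B h\<close> is injective, i.e. that \<open>B\<close> has
  full column rank. If \<open>F\<close> and \<open>R\<close> are independent given \<open>Y\<close>, then
  \<open>P(F = f, Y = y, R = 1) = H f y \<pi>(y)\<close>, so \<open>B = D\<^sub>F\<^sup>-\<^sup>1 H D\<^sub>\<pi>\<close> with the invertible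
  diagonal matrices \<open>D\<^sub>F = diag P(F = f, R = 1)\<close> and \<open>D\<^sub>\<pi> = diag \<pi>(y)\<close>; hence \<open>B\<close> and \<open>H\<close>
  have the same kernel. The largest and smallest singular values of a matrix \<open>G\<close> are the
  maximum and minimum of \<open>|G x|\<close> over unit vectors \<open>x\<close>, because an extremal unit vector is
  an eigenvector of \<open>G\<^sup>T G\<close>. A diagonal factor changes \<open>|G x|\<close> at most by its smallest and
  largest entry, which gives the bound on \<open>\<kappa>(B)\<close>.\<close>

section \<open>Extreme singular values\<close>

lemma quadratic_nonneg_imp_linear_coeff_zero:
  fixes a c :: real
  assumes nonneg: "\<And>t. 0 \<le> t * a + t\<^sup>2 * c"
  shows "a = 0"
proof -
  define s where "s = c + 1"
  have "s > 0" using nonneg[of 1] nonneg[of "-1"] by (simp add: s_def)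
  have "c = s - 1" by (simp add: s_def)
  have "0 \<le> (- a / s) * a + (- a / s)\<^sup>2 * (s - 1)"
    using nonneg[of "- a / s"] unfolding \<open>c = s - 1\<close> .
  also have "\<dots> = - (a / s)\<^sup>2"
    using \<open>s > 0\<close> by (simp add: power2_eq_square field_simps)
  finally show ?thesis using \<open>s > 0\<close> by simp
qed

lemma inner_matrix_transpose:
  fixes A :: "real^'n^'m"
  shows "x \<bullet> (A *v y) = (transpose A *v x) \<bullet> y"
  by (simp add: dot_lmul_matrix)

lemma inner_gram_matrix:
  fixes G :: "real^'n^'m"
  shows "x \<bullet> ((transpose G ** G) *v y) = (G *v x) \<bullet> (G *v y)"
  unfolding matrix_vector_mul_assoc[symmetric] inner_matrix_transpose[of x "transpose G"]
    transpose_transpose ..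

lemma transpose_diff: "transpose (A - B) = transpose A - transpose (B :: 'a::ab_group_add^'n^'m)"
  by (simp add: transpose_def vec_eq_iff)

lemma mat_mult_vector: "mat c *v x = c *\<^sub>R (x :: real^'n)"
  by (simp add: vec_eq_iff matrix_vector_mult_def mat_def mult_delta_left)

lemma neg_matrix_vector_mult: "(- A) *v x = - (A *v x :: 'a::ring_1^'m)"
  by (simp add: vec_eq_iff matrix_vector_mult_def sum_negf)

lemma psd_matrix_null_vector:
  fixes A :: "real^'n^'n"
  assumes symmetric: "transpose A = A" and psd: "\<And>x. 0 \<le> x \<bullet> (A *v x)" and "v \<bullet> (A *v v) = 0"
  shows "A *v v = 0"
proof -
  define w where "w = A *v v"
  have "v \<bullet> w = 0"
    using \<open>v \<bullet> (A *v v) = 0\<close> by (simp add: w_def)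
  have "v \<bullet> (A *v w) = w \<bullet> w"
    unfolding inner_matrix_transpose symmetric w_def ..
  have "A *v (v + t *\<^sub>R w) = w + t *\<^sub>R (A *v w)" for t
    by (simp add: w_def matrix_vector_right_distrib matrix_vector_mult_scaleR)
  then have "(v + t *\<^sub>R w) \<bullet> (A *v (v + t *\<^sub>R w))
      = v \<bullet> w + t * (v \<bullet> (A *v w)) + t * (w \<bullet> w) + t\<^sup>2 * (w \<bullet> (A *v w))" for t
    by (simp add: inner_add_left inner_add_right power2_eq_square) (simp add: algebra_simps)
  then have "0 \<le> t * (2 * (w \<bullet> w)) + t\<^sup>2 * (w \<bullet> (A *v w))" for t
    using psd[of "v + t *\<^sub>R w"] unfolding \<open>v \<bullet> w = 0\<close> \<open>v \<bullet> (A *v w) = w \<bullet> w\<close>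
    by simp
  then have "2 * (w \<bullet> w) = 0"
    by (rule quadratic_nonneg_imp_linear_coeff_zero)
  then show ?thesis by (simp add: w_def)
qed

lemma gram_eigenvalue_of_norm_extremum:
  fixes G :: "real^'n^'m"
  assumes "norm v = 1"
    and extremal: "(\<forall>x. norm (G *v x) \<le> norm (G *v v) * norm x)
      \<or> (\<forall>x. norm (G *v v) * norm x \<le> norm (G *v x))"
  shows "(norm (G *v v))\<^sup>2 \<in> eigenvalues_of (transpose G ** G)"
proof -
  define m where "m = (norm (G *v v))\<^sup>2"
  define A where "A = transpose G ** G - mat m"
  have "transpose A = A" "transpose (- A) = - A"
    by (simp_all add: A_def transpose_diff matrix_transpose_mul)
  have quad: "x \<bullet> (A *v x) = (norm (G *v x))\<^sup>2 - m * (norm x)\<^sup>2"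
    and quad_neg: "x \<bullet> (- A *v x) = m * (norm x)\<^sup>2 - (norm (G *v x))\<^sup>2" for x
    by (simp_all add: A_def neg_matrix_vector_mult matrix_vector_mult_diff_rdistrib mat_mult_vector
        inner_diff_right inner_gram_matrix power2_norm_eq_inner)
  have at_v: "m * (norm v)\<^sup>2 - (norm (G *v v))\<^sup>2 = 0" "(norm (G *v v))\<^sup>2 - m * (norm v)\<^sup>2 = 0"
    using \<open>norm v = 1\<close> by (simp_all add: m_def)
  \<comment> \<open>by extremality of \<open>v\<close>, \<open>A\<close> or \<open>- A\<close> is positive semidefinite
    with null form at \<open>v\<close>\<close>
  from extremal have "A *v v = 0"
  proof
    assume max: "\<forall>x. norm (G *v x) \<le> norm (G *v v) * norm x"
    have le: "(norm (G *v x))\<^sup>2 \<le> m * (norm x)\<^sup>2" for x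
      using power_mono[OF max[rule_format, of x] norm_ge_zero, of 2]
      by (simp add: m_def power_mult_distrib)
    have "- A *v v = 0"
      by (rule psd_matrix_null_vector[OF \<open>transpose (- A) = - A\<close>])
        (use le at_v(1) in \<open>simp_all add: quad_neg\<close>)
    then show ?thesis
      by (simp add: neg_matrix_vector_mult)
  next
    assume min: "\<forall>x. norm (G *v v) * norm x \<le> norm (G *v x)"
    have le: "m * (norm x)\<^sup>2 \<le> (norm (G *v x))\<^sup>2" for x
      using power_mono[OF min[rule_format, of x], of 2]
      by (simp add: m_def power_mult_distrib)
    show ?thesis
      by (rule psd_matrix_null_vector[OF \<open>transpose A = A\<close>])
        (use le at_v(2) in \<open>simp_all add: quad\<close>)
  qed
  then have "(transpose G ** G) *v v = m *\<^sub>R v"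
    by (simp add: A_def matrix_vector_mult_diff_rdistrib mat_mult_vector)
  moreover have "v \<noteq> 0"
    using \<open>norm v = 1\<close> by auto
  ultimately show ?thesis
    unfolding eigenvalues_of_def m_def by blast
qed

lemma symmetric_eigenvectors_orthogonal:
  fixes A :: "real^'n^'n"
  assumes "transpose A = A" and "A *v u = a *\<^sub>R u" and "A *v w = b *\<^sub>R w" and "a \<noteq> b"
  shows "orthogonal u w"
proof -
  have "a * (u \<bullet> w) = (A *v u) \<bullet> w"
    using assms(2) by simp
  also have "\<dots> = u \<bullet> (A *v w)"
    unfolding inner_matrix_transpose[of u] assms(1) ..
  also have "\<dots> = b * (u \<bullet> w)"
    using assms(3) by simp
  finally have "(a - b) * (u \<bullet> w) = 0"
    by (simp add: left_diff_distrib)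
  with \<open>a \<noteq> b\<close> show ?thesis
    by (simp add: orthogonal_def)
qed

lemma finite_eigenvalues_symmetric:
  fixes A :: "real^'n^'n"
  assumes symmetric: "transpose A = A"
  shows "finite (eigenvalues_of A)"
proof -
  define E where "E = eigenvalues_of A"
  have "\<forall>l\<in>E. \<exists>x. x \<noteq> 0 \<and> A *v x = l *\<^sub>R x"
    unfolding E_def eigenvalues_of_def by blast
  then obtain u where u: "\<forall>l\<in>E. u l \<noteq> 0 \<and> A *v u l = l *\<^sub>R u l"
    by (rule bchoice[THEN exE])
  then have nonzero: "u l \<noteq> 0" and eigen: "A *v u l = l *\<^sub>R u l" if "l \<in> E" for l
    using that by simp_all
  have "inj_on u E"
  proof (rule inj_onI)
    fix a b assume "a \<in> E" "b \<in> E" "u a = u b"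
    have "a *\<^sub>R u a = A *v u b"
      using eigen[OF \<open>a \<in> E\<close>] \<open>u a = u b\<close> by simp
    also have "\<dots> = b *\<^sub>R u a"
      using eigen[OF \<open>b \<in> E\<close>] \<open>u a = u b\<close> by simp
    finally show "a = b"
      using nonzero[OF \<open>a \<in> E\<close>] by simp
  qed
  moreover have "pairwise orthogonal (u ` E)"
    using symmetric eigen by (intro pairwise_imageI symmetric_eigenvectors_orthogonal)
  moreover have "0 \<notin> u ` E"
    using nonzero by auto
  ultimately have "finite E"
    by (intro finite_imageD[of u] independent_imp_finite pairwise_orthogonal_independent)
  then show ?thesis
    unfolding E_def .
qed

lemma norm_matrix_vector_normalized:
  fixes G :: "real^'n^'m"
  shows "norm (G *v x) = norm x * norm (G *v (x /\<^sub>R norm x))"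
  by (cases "x = 0") (simp_all add: matrix_vector_mult_scaleR)

lemma norm_matrix_vector_extremes:
  fixes G :: "real^'n^'m"
  obtains v w where "norm v = 1" "norm w = 1"
    "\<And>x. norm (G *v x) \<le> norm (G *v v) * norm x"
    "\<And>x. norm (G *v w) * norm x \<le> norm (G *v x)"
proof -
  let ?S = "sphere (0 :: real^'n) 1"
  have cont: "continuous_on ?S (\<lambda>x. norm (G *v x))"
    by (intro continuous_intros linear_continuous_on matrix_vector_mul_linear)
  obtain v where "v \<in> ?S" and v: "\<And>y. y \<in> ?S \<Longrightarrow> norm (G *v y) \<le> norm (G *v v)"
    using continuous_attains_sup[OF compact_sphere _ cont] by auto
  obtain w where "w \<in> ?S" and w: "\<And>y. y \<in> ?S \<Longrightarrow> norm (G *v w) \<le> norm (G *v y)"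
    using continuous_attains_inf[OF compact_sphere _ cont] by auto
  have normalized: "x /\<^sub>R norm x \<in> ?S" if "x \<noteq> 0" for x
    using that by simp
  show ?thesis
  proof
    show "norm v = 1" "norm w = 1"
      using \<open>v \<in> ?S\<close> \<open>w \<in> ?S\<close> by simp_all
    show "norm (G *v x) \<le> norm (G *v v) * norm x" for x
      using v[OF normalized] norm_matrix_vector_normalized[of G x]
      by (cases "x = 0") (simp_all add: mult.commute mult_left_mono)
    show "norm (G *v w) * norm x \<le> norm (G *v x)" for x
      using w[OF normalized] norm_matrix_vector_normalized[of G x]
      by (cases "x = 0") (simp_all add: mult.commute mult_left_mono)
  qed
qed

lemma norm_gram_eigenvector:
  fixes G :: "real^'n^'m"
  assumes "(transpose G ** G) *v x = l *\<^sub>R x"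
  shows "(norm (G *v x))\<^sup>2 = l * (norm x)\<^sup>2"
  using inner_gram_matrix[of x G x] assms by (simp add: power2_norm_eq_inner)

lemma gram_eigenvalue_le:
  fixes G :: "real^'n^'m"
  assumes "l \<in> eigenvalues_of (transpose G ** G)" and "\<And>x. norm (G *v x) \<le> c * norm x"
  shows "l \<le> c\<^sup>2"
proof -
  obtain x where "x \<noteq> 0" and "(transpose G ** G) *v x = l *\<^sub>R x"
    using assms(1) unfolding eigenvalues_of_def by blast
  then have "l * (norm x)\<^sup>2 = (norm (G *v x))\<^sup>2"
    by (simp add: norm_gram_eigenvector)
  also have "\<dots> \<le> c\<^sup>2 * (norm x)\<^sup>2"
    using power_mono[OF assms(2)[of x] norm_ge_zero, of 2] by (simp add: power_mult_distrib)
  finally show ?thesis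
    using \<open>x \<noteq> 0\<close> by (simp add: mult_le_cancel_right_pos)
qed

lemma gram_eigenvalue_ge:
  fixes G :: "real^'n^'m"
  assumes "l \<in> eigenvalues_of (transpose G ** G)" and "\<And>x. c * norm x \<le> norm (G *v x)"
    and "0 \<le> c"
  shows "c\<^sup>2 \<le> l"
proof -
  obtain x where "x \<noteq> 0" and "(transpose G ** G) *v x = l *\<^sub>R x"
    using assms(1) unfolding eigenvalues_of_def by blast
  have "c\<^sup>2 * (norm x)\<^sup>2 \<le> (norm (G *v x))\<^sup>2"
    using power_mono[OF assms(2)[of x], of 2] \<open>0 \<le> c\<close> by (simp add: power_mult_distrib)
  also have "\<dots> = l * (norm x)\<^sup>2"
    using \<open>(transpose G ** G) *v x = l *\<^sub>R x\<close> by (rule norm_gram_eigenvector)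
  finally show ?thesis
    using \<open>x \<noteq> 0\<close> by (simp add: mult_le_cancel_right_pos)
qed

lemma finite_gram_eigenvalues: "finite (eigenvalues_of (transpose G ** G))"
  by (intro finite_eigenvalues_symmetric) (simp add: matrix_transpose_mul)

lemma sigma_max_eq_norm_maximum:
  fixes G :: "real^'n^'m"
  assumes "norm v = 1" and max: "\<And>x. norm (G *v x) \<le> norm (G *v v) * norm x"
  shows "sigma_max G = norm (G *v v)"
  unfolding sigma_max_def singular_values_def
proof (rule Max_eqI)
  show "finite (sqrt ` eigenvalues_of (transpose G ** G))"
    by (simp add: finite_gram_eigenvalues)
  show "y \<le> norm (G *v v)" if "y \<in> sqrt ` eigenvalues_of (transpose G ** G)" for y
    using that real_sqrt_le_mono[OF gram_eigenvalue_le[OF _ max]] by auto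
  have "(norm (G *v v))\<^sup>2 \<in> eigenvalues_of (transpose G ** G)"
    by (rule gram_eigenvalue_of_norm_extremum) (use assms in auto)
  then show "norm (G *v v) \<in> sqrt ` eigenvalues_of (transpose G ** G)"
    by (rule image_eqI[rotated]) simp
qed

lemma sigma_min_eq_norm_minimum:
  fixes G :: "real^'n^'m"
  assumes "norm w = 1" and min: "\<And>x. norm (G *v w) * norm x \<le> norm (G *v x)"
  shows "sigma_min G = norm (G *v w)"
  unfolding sigma_min_def singular_values_def
proof (rule Min_eqI)
  show "finite (sqrt ` eigenvalues_of (transpose G ** G))"
    by (simp add: finite_gram_eigenvalues)
  show "norm (G *v w) \<le> y" if "y \<in> sqrt ` eigenvalues_of (transpose G ** G)" for y
    using that real_sqrt_le_mono[OF gram_eigenvalue_ge[OF _ min norm_ge_zero]] by auto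
  have "(norm (G *v w))\<^sup>2 \<in> eigenvalues_of (transpose G ** G)"
    by (rule gram_eigenvalue_of_norm_extremum) (use assms in auto)
  then show "norm (G *v w) \<in> sqrt ` eigenvalues_of (transpose G ** G)"
    by (rule image_eqI[rotated]) simp
qed

lemma singular_value_extremes:
  fixes G :: "real^'n^'m"
  obtains v w where "norm v = 1" "norm w = 1"
    "sigma_max G = norm (G *v v)" "sigma_min G = norm (G *v w)"
    "\<And>x. norm (G *v x) \<le> sigma_max G * norm x"
    "\<And>x. sigma_min G * norm x \<le> norm (G *v x)"
proof (rule norm_matrix_vector_extremes[of G])
  fix v w
  assume "norm v = 1" "norm w = 1"
    and max: "\<And>x. norm (G *v x) \<le> norm (G *v v) * norm x"
    and min: "\<And>x. norm (G *v w) * norm x \<le> norm (G *v x)"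
  then have "sigma_max G = norm (G *v v)" "sigma_min G = norm (G *v w)"
    by (simp_all add: sigma_max_eq_norm_maximum sigma_min_eq_norm_minimum)
  with \<open>norm v = 1\<close> \<open>norm w = 1\<close> max min show thesis
    by (intro that) simp_all
qed

lemma norm_le_sigma_max:
  fixes G :: "real^'n^'m"
  shows "norm (G *v x) \<le> sigma_max G * norm x"
  by (rule singular_value_extremes[of G])

lemma sigma_min_le_norm:
  fixes G :: "real^'n^'m"
  shows "sigma_min G * norm x \<le> norm (G *v x)"
  by (rule singular_value_extremes[of G])

lemma sigma_max_nonneg:
  fixes G :: "real^'n^'m"
  shows "0 \<le> sigma_max G"
  by (rule singular_value_extremes[of G]) simp

lemma sigma_max_le:
  fixes G :: "real^'n^'m"
  assumes "\<And>x. norm (G *v x) \<le> c * norm x"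
  shows "sigma_max G \<le> c"
proof (rule singular_value_extremes[of G])
  fix v assume "norm v = 1" "sigma_max G = norm (G *v v)"
  then show ?thesis
    using assms[of v] by simp
qed

lemma sigma_min_ge:
  fixes G :: "real^'n^'m"
  assumes "\<And>x. c * norm x \<le> norm (G *v x)"
  shows "c \<le> sigma_min G"
proof (rule singular_value_extremes[of G])
  fix w assume "norm w = 1" "sigma_min G = norm (G *v w)"
  then show ?thesis
    using assms[of w] by simp
qed

lemma sigma_min_pos:
  fixes G :: "real^'n^'m"
  assumes "inj ((*v) G)"
  shows "0 < sigma_min G"
proof (rule singular_value_extremes[of G])
  fix w assume "norm w = 1" "sigma_min G = norm (G *v w)"
  moreover have "G *v w \<noteq> 0"
    using \<open>norm w = 1\<close> injD[OF assms, of w 0] by auto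
  ultimately show ?thesis by simp
qed

section \<open>Diagonal rescaling\<close>

definition diag_mat :: "('n::finite \<Rightarrow> 'a::zero) \<Rightarrow> 'a^'n^'n" where
  "diag_mat d = (\<chi> i j. if i = j then d i else 0)"

lemma diag_mat_mult_vector: "diag_mat d *v x = (\<chi> i. d i * x $ i)"
  by (simp add: vec_eq_iff diag_mat_def matrix_vector_mult_def mult_delta_left)

lemma diag_scaling_nth:
  fixes H :: "'a::comm_semiring_1^'n^'m"
  shows "(diag_mat e ** H ** diag_mat d) $ i $ j = e i * H $ i $ j * d j"
  by (simp add: matrix_matrix_mult_def diag_mat_def mult_delta_left mult_delta_right)

lemma bij_diag_mat_mult:
  fixes d :: "'n::finite \<Rightarrow> 'a::field"
  assumes "\<And>i. d i \<noteq> 0"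
  shows "bij ((*v) (diag_mat d))"
  by (rule o_bij[where g = "(*v) (diag_mat (\<lambda>i. inverse (d i)))"])
    (simp_all add: fun_eq_iff vec_eq_iff diag_mat_mult_vector assms)

lemma inj_diag_scaling_iff:
  fixes H :: "'a::field^'n^'m"
  assumes "\<And>i. e i \<noteq> 0" and "\<And>j. d j \<noteq> 0"
  shows "inj ((*v) (diag_mat e ** H ** diag_mat d)) \<longleftrightarrow> inj ((*v) H)"
proof -
  have "bij ((*v) (diag_mat e))" "bij ((*v) (diag_mat d))"
    using assms by (simp_all add: bij_diag_mat_mult)
  have comp: "(*v) (diag_mat e ** H ** diag_mat d) = ((*v) (diag_mat e) \<circ> (*v) H) \<circ> (*v) (diag_mat d)"
    by (simp add: fun_eq_iff matrix_vector_mul_assoc matrix_mul_assoc)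
  have "inj ((*v) (diag_mat e ** H ** diag_mat d)) \<longleftrightarrow> inj ((*v) (diag_mat e) \<circ> (*v) H)"
    unfolding comp using \<open>bij ((*v) (diag_mat d))\<close>
    by (simp add: comp_inj_on_iff[symmetric] bij_is_inj bij_is_surj)
  also have "\<dots> \<longleftrightarrow> inj ((*v) H)"
  proof
    assume "inj ((*v) (diag_mat e) \<circ> (*v) H)"
    then show "inj ((*v) H)"
      by (rule inj_on_imageI2)
  next
    assume "inj ((*v) H)"
    with \<open>bij ((*v) (diag_mat e))\<close> show "inj ((*v) (diag_mat e) \<circ> (*v) H)"
      by (simp add: bij_is_inj inj_compose)
  qed
  finally show ?thesis .
qed

lemma norm_diag_mat_mult_le:
  fixes d :: "'n::finite \<Rightarrow> real"
  assumes "\<And>i. \<bar>d i\<bar> \<le> c"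
  shows "norm (diag_mat d *v x) \<le> c * norm x"
proof -
  have "0 \<le> c"
    using assms[of undefined] by linarith
  have "norm (diag_mat d *v x) \<le> norm (c *\<^sub>R x)"
    by (rule norm_le_componentwise_cart)
      (simp add: diag_mat_mult_vector abs_mult assms mult_right_mono \<open>0 \<le> c\<close>)
  with \<open>0 \<le> c\<close> show ?thesis by simp
qed

lemma norm_diag_mat_mult_ge:
  fixes d :: "'n::finite \<Rightarrow> real"
  assumes "\<And>i. c \<le> \<bar>d i\<bar>" and "0 \<le> c"
  shows "c * norm x \<le> norm (diag_mat d *v x)"
proof -
  have "norm (c *\<^sub>R x) \<le> norm (diag_mat d *v x)"
    by (rule norm_le_componentwise_cart)
      (simp add: diag_mat_mult_vector abs_mult assms mult_right_mono)
  with \<open>0 \<le> c\<close> show ?thesis by simp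
qed

lemma cond_number_diag_scaling_le:
  fixes H :: "real^'n^'m"
  assumes inj: "inj ((*v) H)"
    and e: "\<And>i. e_lo \<le> \<bar>e i\<bar> \<and> \<bar>e i\<bar> \<le> e_hi" and "0 < e_lo"
    and d: "\<And>j. d_lo \<le> \<bar>d j\<bar> \<and> \<bar>d j\<bar> \<le> d_hi" and "0 < d_lo"
  shows "cond_number (diag_mat e ** H ** diag_mat d) \<le> (e_hi / e_lo) * (d_hi / d_lo) * cond_number H"
proof -
  define B where "B = diag_mat e ** H ** diag_mat d"
  have B: "B *v x = diag_mat e *v (H *v (diag_mat d *v x))" for x
    by (simp add: B_def matrix_vector_mul_assoc matrix_mul_assoc)
  have "0 \<le> e_hi" "0 \<le> d_hi"
    using e[of undefined] d[of undefined] by linarith+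
  have "norm (B *v x) \<le> e_hi * d_hi * sigma_max H * norm x" for x
  proof -
    have "norm (B *v x) \<le> e_hi * norm (H *v (diag_mat d *v x))"
      unfolding B using e by (intro norm_diag_mat_mult_le) blast
    also have "\<dots> \<le> e_hi * (sigma_max H * norm (diag_mat d *v x))"
      using \<open>0 \<le> e_hi\<close> by (intro mult_left_mono norm_le_sigma_max)
    also have "\<dots> \<le> e_hi * (sigma_max H * (d_hi * norm x))"
      using \<open>0 \<le> e_hi\<close> sigma_max_nonneg d
      by (intro mult_left_mono norm_diag_mat_mult_le) blast+
    finally show ?thesis
      by (simp add: mult_ac)
  qed
  then have max: "sigma_max B \<le> e_hi * d_hi * sigma_max H"
    by (rule sigma_max_le)
  have "e_lo * d_lo * sigma_min H * norm x \<le> norm (B *v x)" for x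
  proof -
    have "e_lo * (sigma_min H * (d_lo * norm x)) \<le> e_lo * (sigma_min H * norm (diag_mat d *v x))"
      using \<open>0 < e_lo\<close> \<open>0 < d_lo\<close> sigma_min_pos[OF inj] d
      by (intro mult_left_mono norm_diag_mat_mult_ge) auto
    also have "\<dots> \<le> e_lo * norm (H *v (diag_mat d *v x))"
      using \<open>0 < e_lo\<close> by (intro mult_left_mono sigma_min_le_norm) simp
    also have "\<dots> \<le> norm (B *v x)"
      unfolding B using e \<open>0 < e_lo\<close> by (intro norm_diag_mat_mult_ge) auto
    finally show ?thesis
      by (simp add: mult_ac)
  qed
  then have min: "e_lo * d_lo * sigma_min H \<le> sigma_min B"
    by (rule sigma_min_ge)
  have "0 < e_lo * d_lo * sigma_min H"
    using \<open>0 < e_lo\<close> \<open>0 < d_lo\<close> sigma_min_pos[OF inj] by simp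
  then have "sigma_max B / sigma_min B \<le> (e_hi * d_hi * sigma_max H) / (e_lo * d_lo * sigma_min H)"
    using max min \<open>0 \<le> e_hi\<close> \<open>0 \<le> d_hi\<close> sigma_max_nonneg[of H]
    by (intro frac_le) auto
  then show ?thesis
    by (simp add: B_def cond_number_def)
qed

section \<open>The shadow-variable matrices\<close>

lemma cond_exp_hY_eq_Bmat: "cond_exp_hY P h f = (Bmat P *v (\<chi> y. h y)) $ f"
  by (simp add: cond_exp_hY_def Bmat_def matrix_vector_mult_def mult.commute)

lemma completeness_iff_inj_Bmat: "completeness P \<longleftrightarrow> inj ((*v) (Bmat P))"
  unfolding completeness_def vec.inj_iff_eq_0 cond_exp_hY_eq_Bmat
proof (intro iffI allI impI)
  fix x assume complete: "\<forall>h. (\<forall>f. (Bmat P *v (\<chi> y. h y)) $ f = 0) \<longrightarrow> (\<forall>y. h y = 0)"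
    and "Bmat P *v x = 0"
  then show "x = 0"
    using complete[rule_format, of "\<lambda>y. x $ y"] by (simp add: vec_eq_iff)
next
  fix h :: "'b \<Rightarrow> real" and y
  assume inj: "\<forall>x. Bmat P *v x = 0 \<longrightarrow> x = 0" and "\<forall>f. (Bmat P *v (\<chi> y. h y)) $ f = 0"
  then have "Bmat P *v (\<chi> y. h y) = 0"
    by (simp add: vec_eq_iff)
  with inj have "(\<chi> y. h y) = 0"
    by blast
  then show "h y = 0"
    by (simp add: vec_eq_iff)
qed

lemma pFYR_True_eq_pFY_piR:
  assumes "cond_indep_FR_given_Y P"
  shows "pFYR P f y True = pFY P f y * piR P y"
proof (cases "pY P y = 0")
  case True
  \<comment> \<open>here \<open>piR P y\<close> is a division by zero, hence \<open>0\<close>,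
    and the event \<open>(f, y, True)\<close> is null\<close>
  have "pFYR P f y True \<le> pY P y"
    unfolding pFYR_def pY_def by (rule measure_pmf.finite_measure_mono) auto
  moreover have "0 \<le> pFYR P f y True"
    by (simp add: pFYR_def)
  ultimately show ?thesis
    using True by (simp add: piR_def)
next
  case False
  have "pFYR P f y True * pY P y = pFY P f y * pYR P y True"
    using assms unfolding cond_indep_FR_given_Y_def by blast
  with False show ?thesis
    unfolding piR_def by (simp add: field_simps)
qed

lemma Bmat_eq_diag_scaling:
  assumes "cond_indep_FR_given_Y P"
  shows "Bmat P = diag_mat (\<lambda>f. 1 / pFR P f) ** Hmat P ** diag_mat (piR P)"
  by (simp add: vec_eq_iff diag_scaling_nth Bmat_def Hmat_def pFYR_True_eq_pFY_piR[OF assms])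

lemma inj_Bmat_iff_inj_Hmat:
  assumes "cond_indep_FR_given_Y P" and "\<And>f. pFR P f \<noteq> 0" and "\<And>y. piR P y \<noteq> 0"
  shows "inj ((*v) (Bmat P)) \<longleftrightarrow> inj ((*v) (Hmat P))"
  unfolding Bmat_eq_diag_scaling[OF assms(1)] using assms(2,3) by (intro inj_diag_scaling_iff) simp_all

lemma cond_number_Bmat_le:
  assumes "cond_indep_FR_given_Y P" and "inj ((*v) (Hmat P))"
    and pi: "\<And>y. pi_lo \<le> piR P y \<and> piR P y \<le> pi_hi" and "0 < pi_lo"
    and pF: "\<And>f. pF_lo \<le> pFR P f \<and> pFR P f \<le> pF_hi" and "0 < pF_lo"
  shows "cond_number (Bmat P) \<le> (pF_hi / pF_lo) * (pi_hi / pi_lo) * cond_number (Hmat P)"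
proof -
  have "pi_lo \<le> \<bar>piR P y\<bar> \<and> \<bar>piR P y\<bar> \<le> pi_hi" for y
    using pi[of y] \<open>0 < pi_lo\<close> by arith
  moreover have "1 / pF_hi \<le> \<bar>1 / pFR P f\<bar> \<and> \<bar>1 / pFR P f\<bar> \<le> 1 / pF_lo" for f
    using pF[of f] \<open>0 < pF_lo\<close> by (simp add: frac_le)
  moreover have "0 < 1 / pF_hi"
    using pF[of undefined] \<open>0 < pF_lo\<close> by simp
  ultimately have "cond_number (Bmat P)
      \<le> ((1 / pF_lo) / (1 / pF_hi)) * (pi_hi / pi_lo) * cond_number (Hmat P)"
    unfolding Bmat_eq_diag_scaling[OF assms(1)]
    using \<open>inj ((*v) (Hmat P))\<close> \<open>0 < pi_lo\<close> by (intro cond_number_diag_scaling_le)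
  then show ?thesis
    by simp
qed

theorem proposition3:
  fixes P :: "('f::finite \<times> 'y::finite \<times> bool) pmf"
    and pi_lo pi_hi pF_lo pF_hi :: real
  assumes pos: "\<forall>f. pFR P f > 0"
  shows "(completeness P \<longleftrightarrow> rank (Bmat P) = CARD('y))
     \<and> ((cond_indep_FR_given_Y P
          \<and> (\<forall>y. pi_lo \<le> piR P y \<and> piR P y \<le> pi_hi)
          \<and> (\<forall>f. pF_lo \<le> pFR P f \<and> pFR P f \<le> pF_hi)
          \<and> pi_lo > 0 \<and> pF_lo > 0)
        \<longrightarrow> ((completeness P \<longleftrightarrow> rank (Hmat P) = CARD('y))
             \<and> (completeness P \<longrightarrow>
                  cond_number (Bmat P) \<le> (pF_hi / pF_lo) * (pi_hi / pi_lo) * cond_number (Hmat P))))"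
proof (intro conjI impI)
  show "completeness P \<longleftrightarrow> rank (Bmat P) = CARD('y)"
    by (simp add: completeness_iff_inj_Bmat full_rank_injective)
  assume "cond_indep_FR_given_Y P
    \<and> (\<forall>y. pi_lo \<le> piR P y \<and> piR P y \<le> pi_hi)
    \<and> (\<forall>f. pF_lo \<le> pFR P f \<and> pFR P f \<le> pF_hi) \<and> pi_lo > 0 \<and> pF_lo > 0"
  then have ci: "cond_indep_FR_given_Y P"
    and pi: "\<And>y. pi_lo \<le> piR P y \<and> piR P y \<le> pi_hi" "0 < pi_lo"
    and pF: "\<And>f. pF_lo \<le> pFR P f \<and> pFR P f \<le> pF_hi" "0 < pF_lo"
    by simp_all
  have "piR P y \<noteq> 0" for y
    using pi(1)[of y] \<open>0 < pi_lo\<close> by linarith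
  with ci pos have complete_iff_inj_H: "completeness P \<longleftrightarrow> inj ((*v) (Hmat P))"
    by (simp add: completeness_iff_inj_Bmat inj_Bmat_iff_inj_Hmat less_imp_neq[symmetric])
  then show "completeness P \<longleftrightarrow> rank (Hmat P) = CARD('y)"
    by (simp add: full_rank_injective)
  assume "completeness P"
  with ci pi pF show "cond_number (Bmat P) \<le> (pF_hi / pF_lo) * (pi_hi / pi_lo) * cond_number (Hmat P)"
    by (intro cond_number_Bmat_le) (simp_all add: complete_iff_inj_H)
qed

end
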